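(* Let $G=(V,E)$ be a complete directed graph with weights $w\in\mathbb{R}^E_{\ge0}$, let $\varepsilon\ge0$, and let $S=\sum_{e\in E}w_e$ and $W(H)=\sum_{e\in H}w_e$ for $H\in\mathcal H$. Let $\mathcal D(\varepsilon)$ be either $\mathcal D^{\mathrm{S},1}(\varepsilon)$ or $\mathcal D^{\mathrm{L},1}(\varepsilon)$. Then, for every Hamiltonian cycle $H\in\mathcal H$, $$\max_{(\Delta^+,\Delta^-)\in\mathcal D(\varepsilon)}\ \sum_{e\in H}\bigl(w_e+\Delta^+_e-\Delta^-_e\bigr)=\min\Bigl\{W(H)+\frac{\varepsilon}{2},\ S\Bigr\}.$$ Consequently, under either of these uncertainty sets, Diff-RTSP reduces to ordinary TSP with the original weights $w$; more precisely, $$\mathrm{OPT}_{\mathrm{RTSP}}(w,\mathcal D(\varepsilon))=\min\Bigl\{\mathrm{OPT}(w)+\frac{\varepsilon}{2},\ S\Bigr\}.$$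
   Context: Complete directed graph: one edge for each ordered pair of distinct vertices. $\mathcal H$ is the set of Hamiltonian cycles of $G$ (directed cycles visiting every vertex exactly once), identified with their edge sets. $E_{\mathrm{in}}(u)$ and $E_{\mathrm{out}}(u)$ are the edges entering/leaving $u$. A pair $(\Delta^+,\Delta^-)\in\mathbb{R}^{E}_{\ge0}\times\mathbb{R}^{E}_{\ge0}$ satisfies conservation if $\sum_{e\in E_{\mathrm{in}}(u)}\Delta^-_e=\sum_{e\in E_{\mathrm{out}}(u)}\Delta^+_e$ for all $u\in V$. $\mathcal D^{\mathrm{S},1}(\varepsilon)$ (resp. $\mathcal D^{\mathrm{L},1}(\varepsilon)$) is the set of such pairs satisfying conservation, $\Delta^-\le w$ (resp. $\Delta^-\le w+\Delta^+$) entrywise, and $\sum_{e\in E}(\Delta^+_e+\Delta^-_e)\le\varepsilon$. Further, $\mathrm{OPT}(w)=\min_{H\in\mathcal H}W(H)$ is the ordinary TSP value and $\mathrm{OPT}_{\mathrm{RTSP}}(w,\mathcal D(\varepsilon))=\min_{H\in\mathcal H}\max_{(\Delta^+,\Delta^-)\in\mathcal D(\varepsilon)}\sum_{e\in H}(w_e+\Delta^+_e-\Delta^-_e)$ is the Diff-RTSP value. *)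

theory Defs
  imports Complex_Main "Graph_Theory.Kuratowski"
begin

(* The library's cycle has positive length and no repeated vertex, and it admits the 2-cycle
   u, v, u, which is the Hamiltonian cycle of the complete digraph on two vertices. *)
definition hamiltonian_cycles :: "('a, 'b) pre_digraph \<Rightarrow> 'b set set" where
  "hamiltonian_cycles G = {set p | p. pre_digraph.cycle G p \<and> tail G ` set p = verts G}"

definition tour_weight :: "('b \<Rightarrow> real) \<Rightarrow> 'b set \<Rightarrow> real" where
  "tour_weight w H = (\<Sum>e\<in>H. w e)"

(* Vectors indexed by the arcs are total functions; their values off arcs G are irrelevant. *)
definition nonneg_vec :: "('a, 'b) pre_digraph \<Rightarrow> ('b \<Rightarrow> real) \<Rightarrow> bool" where
  "nonneg_vec G x \<longleftrightarrow> (\<forall>e\<in>arcs G. 0 \<le> x e)"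

type_synonym 'b diffs = "('b \<Rightarrow> real) \<times> ('b \<Rightarrow> real)"

definition conservation ::
  "('a, 'b) pre_digraph \<Rightarrow> ('b \<Rightarrow> real) \<Rightarrow> ('b \<Rightarrow> real) \<Rightarrow> bool" where
  "conservation G dp dm \<longleftrightarrow>
     (\<forall>u\<in>verts G. (\<Sum>e\<in>in_arcs G u. dm e) = (\<Sum>e\<in>out_arcs G u. dp e))"

(* In every pair the first component is the increase, the second the decrease. *)
definition diffs_S1 :: "('a, 'b) pre_digraph \<Rightarrow> ('b \<Rightarrow> real) \<Rightarrow> real \<Rightarrow> 'b diffs set" where
  "diffs_S1 G w \<epsilon> = {(dp, dm). nonneg_vec G dp \<and> nonneg_vec G dm \<and> conservation G dp dm \<and>
     (\<forall>e\<in>arcs G. dm e \<le> w e) \<and> (\<Sum>e\<in>arcs G. dp e + dm e) \<le> \<epsilon>}"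

definition diffs_L1 :: "('a, 'b) pre_digraph \<Rightarrow> ('b \<Rightarrow> real) \<Rightarrow> real \<Rightarrow> 'b diffs set" where
  "diffs_L1 G w \<epsilon> = {(dp, dm). nonneg_vec G dp \<and> nonneg_vec G dm \<and> conservation G dp dm \<and>
     (\<forall>e\<in>arcs G. dm e \<le> w e + dp e) \<and> (\<Sum>e\<in>arcs G. dp e + dm e) \<le> \<epsilon>}"

definition perturbed_weight :: "('b \<Rightarrow> real) \<Rightarrow> 'b diffs \<Rightarrow> 'b set \<Rightarrow> real" where
  "perturbed_weight w d H = (\<Sum>e\<in>H. w e + fst d e - snd d e)"

(* Max is only meaningful for finite sets, so the maximum is taken with GREATEST; like Max, it is
   meaningful only where the maximum is attained. *)
definition worst_case_weight :: "('b \<Rightarrow> real) \<Rightarrow> 'b diffs set \<Rightarrow> 'b set \<Rightarrow> real" where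
  "worst_case_weight w D H = (GREATEST x. x \<in> (\<lambda>d. perturbed_weight w d H) ` D)"

definition opt_tsp :: "('a, 'b) pre_digraph \<Rightarrow> ('b \<Rightarrow> real) \<Rightarrow> real" where
  "opt_tsp G w = Min (tour_weight w ` hamiltonian_cycles G)"

definition opt_rtsp :: "('a, 'b) pre_digraph \<Rightarrow> ('b \<Rightarrow> real) \<Rightarrow> 'b diffs set \<Rightarrow> real" where
  "opt_rtsp G w D = Min (worst_case_weight w D ` hamiltonian_cycles G)"

end

theory Submission
  imports Defs
begin

text \<open>
  Conservation, summed over all vertices, says that the total decrease equals the total increase.
  Within the budget \<open>\<epsilon>\<close>, each of the two totals is therefore at most \<open>\<epsilon> / 2\<close>, so no tour can
  become more expensive by more than \<open>\<epsilon> / 2\<close>. Moreover the perturbed weights are nonnegative and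
  still add up to \<open>S\<close> over all arcs, so no tour can cost more than \<open>S\<close>.

  The smaller bound is attained. A Hamiltonian cycle \<open>H\<close> leaves every vertex by exactly one of
  its arcs, so any weight that is removed from arcs outside \<open>H\<close> can be collected, at the head of
  those arcs, by the arc of \<open>H\<close> that leaves this vertex. Shrinking all arcs outside \<open>H\<close> by a common
  factor moves any prescribed amount between \<open>0\<close> and \<open>S - W(H)\<close> onto \<open>H\<close>; the amount
  \<open>min (\<epsilon> / 2) (S - W(H))\<close> is affordable and gives equality
  (\<open>exists_optimal_diffs\<close>). This perturbation never decreases an arc by more than its original
  weight, hence it lies in the smaller uncertainty set, while the upper bounds
  (\<open>perturbed_weight_le\<close>) hold in the larger one; so both sets, and any set between them, have the
  same worst case.

  The worst case is thus the value of the monotone function \<open>x \<mapsto> min (x + \<epsilon> / 2) S\<close> at \<open>W(H)\<close>.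
  Monotone functions commute with minima over finite nonempty sets, which gives the formula for
  the optimum. Completeness of the digraph provides the nonemptiness, since any enumeration of the
  vertices closes up to a Hamiltonian cycle.
\<close>

section \<open>Hamiltonian cycles as sets of arcs\<close>

text \<open>
  The worst-case computation sees a Hamiltonian cycle only through this property: the weight
  released at a vertex has a unique arc of the cycle to go to.
\<close>

lemma (in wf_digraph) hamiltonian_cycle_bij_tail:
  assumes "H \<in> hamiltonian_cycles G"
  shows "H \<subseteq> arcs G" and "bij_betw (tail G) H (verts G)"
proof -
  obtain p where H: "H = set p" and p: "cycle p" and verts: "tail G ` set p = verts G"
    using assms by (auto simp: hamiltonian_cycles_def)
  obtain u where walk: "awalk u p u" and dist: "distinct (tl (awalk_verts u p))" and "p \<noteq> []"
    using p by (auto simp: cycle_def)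
  obtain e es where p_eq: "p = e # es"
    using \<open>p \<noteq> []\<close> by (cases p) auto
  have tail_e: "tail G e = u" and last: "awlast u p = u"
    using walk p_eq by (auto simp: awalk_def awlast_if_cas)
  \<comment> \<open>The vertices of the walk after the first one are the tails of the arcs up to rotation.\<close>
  have "tl (awalk_verts u p) = map (tail G) es @ [u]"
    using last p_eq by (auto simp: awalk_verts_conv)
  then have "distinct (map (tail G) p)"
    using dist tail_e p_eq by auto
  then show "bij_betw (tail G) H (verts G)"
    using verts H by (simp add: bij_betw_def distinct_map)
  show "H \<subseteq> arcs G"
    using walk H by (auto simp: awalk_def)
qed

lemma (in fin_digraph) finite_hamiltonian_cycles: "finite (hamiltonian_cycles G)"
proof (rule finite_subset)
  show "hamiltonian_cycles G \<subseteq> Pow (arcs G)"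
    using hamiltonian_cycle_bij_tail(1) by auto
qed simp

lemma (in pre_digraph) exists_cas_through:
  assumes "xs \<noteq> []" and "successively (\<lambda>u v. (u, v) \<in> arcs_ends G) (xs @ [y])"
  shows "\<exists>p. cas (hd xs) p y \<and> map (tail G) p = xs \<and> set p \<subseteq> arcs G"
  using assms
proof (induction xs rule: list_nonempty_induct)
  case (single x)
  then obtain e where "e \<in> arcs G" "tail G e = x" "head G e = y"
    by (auto simp: arcs_ends_conv)
  then show ?case
    by (intro exI[of _ "[e]"]) auto
next
  case (cons x xs)
  then have "(x, hd xs) \<in> arcs_ends G"
    and succ: "successively (\<lambda>u v. (u, v) \<in> arcs_ends G) (xs @ [y])"
    by (auto simp: successively_Cons)
  then obtain e where e: "e \<in> arcs G" "tail G e = x" "head G e = hd xs"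
    by (auto simp: arcs_ends_conv)
  obtain p where "cas (hd xs) p y" "map (tail G) p = xs" "set p \<subseteq> arcs G"
    using cons.IH[OF succ] by blast
  with e show ?case
    by (intro exI[of _ "e # p"]) auto
qed

text \<open>
  Any enumeration of the vertices can be closed up to a cycle. With a single vertex this would
  require a loop, hence the bound on the number of vertices.
\<close>

lemma hamiltonian_cycles_nonempty:
  fixes G :: "('a, 'b) pre_digraph"
  assumes complete: "complete_digraph n G" and "n \<ge> 2"
  shows "hamiltonian_cycles G \<noteq> {}"
proof -
  interpret graph G
    using complete by (simp add: complete_digraph_def)
  have ends: "arcs_ends G = {(u, v). (u, v) \<in> verts G \<times> verts G \<and> u \<noteq> v}"
    and card: "card (verts G) \<ge> 2"
    using assms by (auto simp: complete_digraph_def)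
  obtain xs where xs: "set xs = verts G" "distinct xs"
    using finite_distinct_list[OF finite_verts] by blast
  have len: "length xs \<ge> 2"
    using card xs distinct_card by fastforce
  then obtain x y ys where xs_eq: "xs = x # y # ys"
    by (metis Suc_le_length_iff numeral_2_eq_2)
  have adj: "successively (\<noteq>) zs" if "distinct zs" for zs :: "'a list"
    using that by (auto simp: successively_conv_nth distinct_conv_nth)
  have "successively (\<noteq>) (y # ys @ [x])"
    by (rule adj) (use xs(2) xs_eq in auto)
  then have step: "successively (\<noteq>) (xs @ [x])"
    using xs(2) xs_eq by simp
  have "successively (\<lambda>u v. (u, v) \<in> arcs_ends G) (xs @ [x])"
    by (rule successively_mono[OF step]) (use xs(1) xs_eq ends in auto)
  then obtain p where p: "cas x p x" "map (tail G) p = xs" "set p \<subseteq> arcs G"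
    using exists_cas_through[of xs x] xs_eq by (metis list.distinct(1) list.sel(1))
  have "p \<noteq> []"
    using p(2) xs_eq by auto
  have "awlast x p = x"
    using p(1) by (rule awlast_if_cas)
  then have "awalk_verts x p = xs @ [x]"
    using p(2) \<open>p \<noteq> []\<close> by (simp add: awalk_verts_conv)
  then have "distinct (tl (awalk_verts x p))"
    using xs(2) xs_eq by auto
  moreover have "awalk x p x"
    using p xs xs_eq by (auto simp: awalk_def)
  ultimately have "cycle p"
    using \<open>p \<noteq> []\<close> by (auto simp: cycle_def)
  moreover have "tail G ` set p = verts G"
    using p(2) xs(1) by (metis set_map)
  ultimately show ?thesis
    by (auto simp: hamiltonian_cycles_def)
qed

section \<open>The worst case for a fixed tour\<close>

lemma (in fin_digraph) conservation_total:
  assumes "conservation G dp dm"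
  shows "(\<Sum>e\<in>arcs G. dm e) = (\<Sum>e\<in>arcs G. dp e)"
proof -
  have "(\<Sum>e\<in>arcs G. dm e) = (\<Sum>u\<in>verts G. \<Sum>e\<in>in_arcs G u. dm e)"
    unfolding in_arcs_def by (rule sum.group[symmetric]) auto
  also have "\<dots> = (\<Sum>u\<in>verts G. \<Sum>e\<in>out_arcs G u. dp e)"
    using assms by (simp add: conservation_def)
  also have "\<dots> = (\<Sum>e\<in>arcs G. dp e)"
    unfolding out_arcs_def by (rule sum.group) auto
  finally show ?thesis .
qed

lemma diffs_S1_subset_diffs_L1: "diffs_S1 G w \<epsilon> \<subseteq> diffs_L1 G w \<epsilon>"
  by (force simp: diffs_S1_def diffs_L1_def nonneg_vec_def)

text \<open>
  The bound \<open>\<epsilon> / 2\<close> comes from discarding all decreases on \<open>H\<close> and all increases outside \<open>H\<close>, the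
  bound by the total weight from extending the sum from \<open>H\<close> to all arcs.
\<close>

lemma (in fin_digraph) perturbed_weight_le:
  assumes d: "d \<in> diffs_L1 G w \<epsilon>" and H: "H \<subseteq> arcs G"
  shows "perturbed_weight w d H \<le> min (tour_weight w H + \<epsilon> / 2) (\<Sum>e\<in>arcs G. w e)"
proof -
  obtain dp dm where d_eq: "d = (dp, dm)"
    and nonneg: "\<And>e. e \<in> arcs G \<Longrightarrow> 0 \<le> dp e" "\<And>e. e \<in> arcs G \<Longrightarrow> 0 \<le> dm e"
    and cons: "conservation G dp dm"
    and le: "\<And>e. e \<in> arcs G \<Longrightarrow> dm e \<le> w e + dp e"
    and budget: "(\<Sum>e\<in>arcs G. dp e + dm e) \<le> \<epsilon>"
    using d by (auto simp: diffs_L1_def nonneg_vec_def)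
  note total = conservation_total[OF cons]
  have half: "(\<Sum>e\<in>arcs G. dp e) \<le> \<epsilon> / 2"
    using budget total by (simp add: sum.distrib)
  have "perturbed_weight w d H \<le> (\<Sum>e\<in>H. w e + dp e)"
    unfolding perturbed_weight_def d_eq using nonneg H by (intro sum_mono) auto
  also have "\<dots> = tour_weight w H + (\<Sum>e\<in>H. dp e)"
    by (simp add: sum.distrib tour_weight_def)
  also have "(\<Sum>e\<in>H. dp e) \<le> (\<Sum>e\<in>arcs G. dp e)"
    using H nonneg by (intro sum_mono2) auto
  finally have 1: "perturbed_weight w d H \<le> tour_weight w H + \<epsilon> / 2"
    using half by simp
  have "perturbed_weight w d H \<le> (\<Sum>e\<in>arcs G. w e + dp e - dm e)"
    unfolding perturbed_weight_def d_eq using H le by (auto intro!: sum_mono2)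
  also have "\<dots> = (\<Sum>e\<in>arcs G. w e)"
    using total by (simp add: sum.distrib sum_subtractf)
  finally show ?thesis
    using 1 by simp
qed

text \<open>
  The smaller of the two bounds is attained as soon as nothing is decreased on \<open>H\<close> and nothing is increased
  outside \<open>H\<close>, and either the budget is used up or no weight is left outside \<open>H\<close>. Since conservation
  only prescribes the total increase at each vertex, the arc of \<open>H\<close> leaving the vertex can take it
  all.
\<close>

lemma (in fin_digraph) exists_optimal_diffs:
  assumes w: "nonneg_vec G w" and "\<epsilon> \<ge> 0"
    and H: "H \<subseteq> arcs G" and bij: "bij_betw (tail G) H (verts G)"
  shows "\<exists>d\<in>diffs_S1 G w \<epsilon>.
    perturbed_weight w d H = min (tour_weight w H + \<epsilon> / 2) (\<Sum>e\<in>arcs G. w e)"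
proof -
  define R where "R = (\<Sum>e\<in>arcs G - H. w e)"
  define \<delta> where "\<delta> = min (\<epsilon> / 2) R"
  \<comment> \<open>If there is no weight outside \<open>H\<close>, then \<open>\<delta> = R = 0\<close> and division by zero gives \<open>t = 0\<close>.\<close>
  define t where "t = \<delta> / R"
  define dm where "dm e = (if e \<in> H then 0 else t * w e)" for e
  define dp where "dp e = (if e \<in> H then \<Sum>e'\<in>in_arcs G (tail G e). dm e' else 0)" for e
  have w0: "0 \<le> w e" if "e \<in> arcs G" for e
    using w that by (simp add: nonneg_vec_def)
  have R0: "R \<ge> 0"
    unfolding R_def using w0 by (intro sum_nonneg) auto
  have S: "(\<Sum>e\<in>arcs G. w e) = R + tour_weight w H"
    unfolding R_def tour_weight_def using H by (intro sum.subset_diff) auto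
  have t: "0 \<le> t" "t \<le> 1" and tR: "t * R = \<delta>"
    using R0 \<open>\<epsilon> \<ge> 0\<close> by (auto simp: t_def \<delta>_def divide_le_eq_1)
  have dm0: "0 \<le> dm e" and dm_le: "dm e \<le> w e" if "e \<in> arcs G" for e
    using w0[OF that] t by (auto simp: dm_def mult_left_le_one_le)
  have dp0: "0 \<le> dp e" for e
    unfolding dp_def by (auto intro!: sum_nonneg dm0)
  have cons: "conservation G dp dm"
    unfolding conservation_def
  proof
    fix u assume "u \<in> verts G"
    then obtain h where h: "h \<in> H" "tail G h = u"
      using bij unfolding bij_betw_def by (metis imageE)
    have "(\<Sum>e\<in>out_arcs G u. dp e) = (\<Sum>e\<in>{h}. dp e)"
    proof (rule sum.mono_neutral_right)
      show "\<forall>e\<in>out_arcs G u - {h}. dp e = 0"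
        using bij h by (auto simp: dp_def bij_betw_def dest: inj_onD)
    qed (use h H in auto)
    also have "\<dots> = (\<Sum>e\<in>in_arcs G u. dm e)"
      using h by (simp add: dp_def)
    finally show "(\<Sum>e\<in>in_arcs G u. dm e) = (\<Sum>e\<in>out_arcs G u. dp e)" ..
  qed
  have "(\<Sum>e\<in>arcs G. dm e) = (\<Sum>e\<in>arcs G - H. dm e)"
    by (rule sum.mono_neutral_right) (auto simp: dm_def)
  also have "\<dots> = t * R"
    by (simp add: dm_def R_def sum_distrib_left)
  finally have sum_dm: "(\<Sum>e\<in>arcs G. dm e) = \<delta>"
    using tR by simp
  then have sum_dp: "(\<Sum>e\<in>arcs G. dp e) = \<delta>"
    using conservation_total[OF cons] by simp
  have "(\<Sum>e\<in>arcs G. dp e + dm e) \<le> \<epsilon>"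
    using sum_dm sum_dp by (simp add: sum.distrib \<delta>_def)
  then have "(dp, dm) \<in> diffs_S1 G w \<epsilon>"
    using cons dm0 dm_le dp0 by (simp add: diffs_S1_def nonneg_vec_def)
  moreover have "perturbed_weight w (dp, dm) H
      = min (tour_weight w H + \<epsilon> / 2) (\<Sum>e\<in>arcs G. w e)"
  proof -
    have "(\<Sum>e\<in>H. dp e) = \<delta>"
      unfolding sum_dp[symmetric] using H by (intro sum.mono_neutral_left) (auto simp: dp_def)
    moreover have "perturbed_weight w (dp, dm) H = tour_weight w H + (\<Sum>e\<in>H. dp e)"
      by (simp add: perturbed_weight_def tour_weight_def dm_def sum.distrib)
    ultimately show ?thesis
      unfolding S \<delta>_def by (simp add: min_def)
  qed
  ultimately show ?thesis
    by blast
qed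

theorem proposition3p3:
  fixes G :: "('a, 'b) pre_digraph" and w :: "'b \<Rightarrow> real" and \<epsilon> S :: real
    and D :: "'b diffs set"
  assumes "complete_digraph (card (verts G)) G"
    and "card (verts G) \<ge> 2"
    and "nonneg_vec G w"
    and "\<epsilon> \<ge> 0"
    and "S = (\<Sum>e\<in>arcs G. w e)"
    and "D = diffs_S1 G w \<epsilon> \<or> D = diffs_L1 G w \<epsilon>"
  shows "(\<forall>H\<in>hamiltonian_cycles G.
            (\<exists>d\<in>D. perturbed_weight w d H = worst_case_weight w D H) \<and>
            (\<forall>d\<in>D. perturbed_weight w d H \<le> worst_case_weight w D H) \<and>
            worst_case_weight w D H = min (tour_weight w H + \<epsilon> / 2) S) \<and>
         opt_rtsp G w D = min (opt_tsp G w + \<epsilon> / 2) S"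
proof -
  interpret graph G
    using assms(1) by (simp add: complete_digraph_def)
  have D: "diffs_S1 G w \<epsilon> \<subseteq> D" "D \<subseteq> diffs_L1 G w \<epsilon>"
    using assms(6) diffs_S1_subset_diffs_L1 by auto
  let ?f = "\<lambda>x. min (x + \<epsilon> / 2) S"
  have attained: "\<exists>d\<in>D. perturbed_weight w d H = ?f (tour_weight w H)"
    and bound: "\<forall>d\<in>D. perturbed_weight w d H \<le> ?f (tour_weight w H)"
    if "H \<in> hamiltonian_cycles G" for H
    using hamiltonian_cycle_bij_tail[OF that] exists_optimal_diffs[OF assms(3,4)]
      perturbed_weight_le D assms(5) by blast+
  have worst: "worst_case_weight w D H = ?f (tour_weight w H)" if "H \<in> hamiltonian_cycles G" for H
    unfolding worst_case_weight_def
    by (rule Greatest_equality) (use attained[OF that] bound[OF that] in \<open>force simp del: min.bounded_iff\<close>)+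
  have "mono ?f"
    by (auto simp: mono_def min_def)
  have "opt_rtsp G w D = Min (?f ` tour_weight w ` hamiltonian_cycles G)"
    unfolding opt_rtsp_def image_image using worst by (metis (no_types, lifting) image_cong)
  also have "\<dots> = ?f (opt_tsp G w)"
    unfolding opt_tsp_def
    by (rule mono_Min_commute[symmetric])
      (use \<open>mono ?f\<close> finite_hamiltonian_cycles hamiltonian_cycles_nonempty[OF assms(1,2)] in auto)
  finally show ?thesis
    using worst attained bound by simp
qed

end
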